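(* Let $(X,d)$ be a compact metric space, let $f_n:X\to X$ be continuous for every $n\ge0$, let $A=(a_{ij})_{N\times N}$ be a transition matrix, and let $\{V_{i,n}\}_{n=0}^\infty$, $1\le i\le N$, be sequences of nonempty closed subsets of $X$. For $\alpha=(a_0,a_1,\dots)\in\Sigma_N^+(A)$ and $m,n\ge0$ let $$V_\alpha^{m,n}:=\bigcap_{k=0}^{m}f_n^{-k}(V_{a_k,n+k}),\qquad \mathcal H_\alpha^{m,n}:=\bigcap_{k=0}^{m}\bar f_n^{-k}(\langle V_{a_k,n+k}\rangle).$$ Then, for any $\alpha\in\Sigma_N^+(A)$ and $n\ge0$, the diameter $d(V_\alpha^{m,n})$ converges to $0$ as $m\to\infty$ if and only if the diameter $\mathcal H_d(\mathcal H_\alpha^{m,n})$ converges to $0$ as $m\to\infty$. Further, for any $\alpha\in\Sigma_N^+(A)$, $d(V_\alpha^{m,n})$ converges to $0$ as $m\to\infty$ uniformly with respect to $n\ge0$ if and only if $\mathcal H_d(\mathcal H_\alpha^{m,n})$ converges to $0$ as $m\to\infty$ uniformly with respect to $n\ge0$.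
   Context: $\mathcal K(X)$ is the set of all nonempty compact subsets of $X$ with the Hausdorff metric $\mathcal H_d(B,C):=\max\{\sup_{b\in B}d(b,C),\sup_{c\in C}d(c,B)\}$, where $d(x,B)=\inf_{b\in B}d(x,b)$. $d(B)$ denotes the diameter of $B\subset X$ with respect to $d$, and $\mathcal H_d(\mathcal U)$ the diameter of $\mathcal U\subset\mathcal K(X)$ with respect to $\mathcal H_d$; the diameter of the empty set is $0$. For nonempty $K\subset X$, $\langle K\rangle:=\{B\in\mathcal K(X):B\subset K\}$; $\bar f_n:\mathcal K(X)\to\mathcal K(X)$ is $\bar f_n(B):=f_n(B)$. For a sequence of maps $g_n$ (here $g_n=f_n$ or $g_n=\bar f_n$), $g_i^n:=g_{i+n-1}\circ\cdots\circ g_i$ for $n\ge1$, $g_i^0$ is the identity, and $g_i^{-n}:=(g_i^n)^{-1}$ (preimage). A transition matrix is a matrix $A=(a_{ij})_{N\times N}$, $N\ge2$, with $a_{ij}\in\{0,1\}$, $\sum_{j=1}^N a_{ij}\ge1$ for all $i$ and $\sum_{i=1}^N a_{ij}\ge1$ for all $j$. $\Sigma_N^+(A):=\{s=(s_0,s_1,\dots):1\le s_j\le N,\ a_{s_js_{j+1}}=1,\ j\ge0\}$. *)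

theory Defs
  imports "HOL-Analysis.Analysis"
begin

text \<open>
  A metric space is a carrier \<open>X\<close> with a distance \<open>d\<close>, as in the locale \<^locale>\<open>Metric_space\<close>, so
  that the same notion of diameter serves both \<open>d\<close> and the Hausdorff metric of \<open>d\<close> on the compact
  subsets of \<open>X\<close>. The lemmas \<open>set_diameter_dist\<close> and \<open>point_set_dist_dist\<close> compare the next
  two definitions with their type-class counterparts. Suprema and infima are those of the reals, hence
  meaningful only for bounded nonempty families; here every set lies in a compact space.
\<close>

definition set_diameter :: "('a \<Rightarrow> 'a \<Rightarrow> real) \<Rightarrow> 'a set \<Rightarrow> real" where
  "set_diameter d S = (if S = {} then 0 else SUP (x, y)\<in>S \<times> S. d x y)"

definition point_set_dist :: "('a \<Rightarrow> 'a \<Rightarrow> real) \<Rightarrow> 'a \<Rightarrow> 'a set \<Rightarrow> real" where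
  "point_set_dist d x B = (INF b\<in>B. d x b)"

definition hausdorff_dist :: "('a \<Rightarrow> 'a \<Rightarrow> real) \<Rightarrow> 'a set \<Rightarrow> 'a set \<Rightarrow> real" where
  "hausdorff_dist d B C = max (SUP b\<in>B. point_set_dist d b C) (SUP c\<in>C. point_set_dist d c B)"

lemma set_diameter_dist: "set_diameter dist S = diameter S"
  by (simp add: set_diameter_def diameter_def)

lemma point_set_dist_dist: "B \<noteq> {} \<Longrightarrow> point_set_dist dist x B = infdist x B"
  by (simp add: point_set_dist_def infdist_def)

definition compacts :: "'a set \<Rightarrow> ('a \<Rightarrow> 'a \<Rightarrow> real) \<Rightarrow> 'a set set" where
  "compacts X d = {B. compactin (Metric_space.mtopology X d) B \<and> B \<noteq> {}}"

definition compacts_in :: "'a set \<Rightarrow> ('a \<Rightarrow> 'a \<Rightarrow> real) \<Rightarrow> 'a set \<Rightarrow> 'a set set" where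
  "compacts_in X d K = {B \<in> compacts X d. B \<subseteq> K}"

definition induced_map :: "(nat \<Rightarrow> 'a \<Rightarrow> 'a) \<Rightarrow> nat \<Rightarrow> 'a set \<Rightarrow> 'a set" where
  "induced_map f n B = f n ` B"

text \<open>\<open>iter g i n\<close> is the composition of the \<open>n\<close> maps \<open>g i\<close>, ..., \<open>g (i + n - 1)\<close>, with \<open>g i\<close> applied first.\<close>

primrec iter :: "(nat \<Rightarrow> 'b \<Rightarrow> 'b) \<Rightarrow> nat \<Rightarrow> nat \<Rightarrow> 'b \<Rightarrow> 'b" where
  "iter g i 0 = id"
| "iter g i (Suc n) = g (i + n) \<circ> iter g i n"

text \<open>The maps are self-maps of the carrier \<open>Y\<close>, so preimages are taken within \<open>Y\<close>.\<close>

definition iter_preimage :: "'b set \<Rightarrow> (nat \<Rightarrow> 'b \<Rightarrow> 'b) \<Rightarrow> nat \<Rightarrow> nat \<Rightarrow> 'b set \<Rightarrow> 'b set" where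
  "iter_preimage Y g i n S = {y \<in> Y. iter g i n y \<in> S}"

text \<open>Matrix indices and symbols range over \<open>{1..N}\<close>; entries of \<open>A\<close> outside that range are irrelevant.\<close>

definition transition_matrix :: "nat \<Rightarrow> (nat \<Rightarrow> nat \<Rightarrow> nat) \<Rightarrow> bool" where
  "transition_matrix N A \<longleftrightarrow>
     N \<ge> 2 \<and>
     (\<forall>i\<in>{1..N}. \<forall>j\<in>{1..N}. A i j \<in> {0, 1}) \<and>
     (\<forall>i\<in>{1..N}. (\<Sum>j=1..N. A i j) \<ge> 1) \<and>
     (\<forall>j\<in>{1..N}. (\<Sum>i=1..N. A i j) \<ge> 1)"

definition one_sided_shift :: "nat \<Rightarrow> (nat \<Rightarrow> nat \<Rightarrow> nat) \<Rightarrow> (nat \<Rightarrow> nat) set" where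
  "one_sided_shift N A = {s. \<forall>j. s j \<in> {1..N} \<and> A (s j) (s (Suc j)) = 1}"

definition V_itin ::
  "'a set \<Rightarrow> (nat \<Rightarrow> 'a \<Rightarrow> 'a) \<Rightarrow> (nat \<Rightarrow> nat \<Rightarrow> 'a set) \<Rightarrow> (nat \<Rightarrow> nat) \<Rightarrow> nat \<Rightarrow> nat \<Rightarrow> 'a set" where
  "V_itin X f V \<alpha> m n = (\<Inter>k\<in>{0..m}. iter_preimage X f n k (V (\<alpha> k) (n + k)))"

definition H_itin ::
  "'a set \<Rightarrow> ('a \<Rightarrow> 'a \<Rightarrow> real) \<Rightarrow> (nat \<Rightarrow> 'a \<Rightarrow> 'a) \<Rightarrow> (nat \<Rightarrow> nat \<Rightarrow> 'a set) \<Rightarrow>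
     (nat \<Rightarrow> nat) \<Rightarrow> nat \<Rightarrow> nat \<Rightarrow> 'a set set" where
  "H_itin X d f V \<alpha> m n =
     (\<Inter>k\<in>{0..m}.
        iter_preimage (compacts X d) (induced_map f) n k (compacts_in X d (V (\<alpha> k) (n + k))))"

end

theory Submission
  imports Defs
begin

text \<open>
  A nonempty compact set has its orbit under the induced maps inside the sets \<open>\<langle>V\<rangle>\<close> exactly when
  all its points have their orbits inside the sets \<open>V\<close>; hence the set of compact sets with a given
  itinerary is \<open>\<langle>W\<rangle>\<close>, where \<open>W\<close> is the set of points with that itinerary. Two subsets of \<open>W\<close> have
  Hausdorff distance at most the diameter of \<open>W\<close>, and singletons embed \<open>W\<close> isometrically into
  \<open>\<langle>W\<rangle>\<close>, so the two diameters are not merely comparable but equal.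
\<close>

lemma set_diameter_least:
  assumes "\<And>x y. x \<in> S \<Longrightarrow> y \<in> S \<Longrightarrow> d x y \<le> D" "S \<noteq> {}"
  shows "set_diameter d S \<le> D"
  using assms by (auto simp: set_diameter_def intro!: cSUP_least)

text \<open>A real \<open>SUP\<close> dominates its members only when the family is bounded above;
  \<open>D\<close> serves as a witness of that and does not enter the conclusion.\<close>

lemma set_diameter_upper:
  assumes "\<And>x y. x \<in> S \<Longrightarrow> y \<in> S \<Longrightarrow> d x y \<le> D" "x \<in> S" "y \<in> S"
  shows "d x y \<le> set_diameter d S"
proof -
  have "bdd_above ((\<lambda>(x, y). d x y) ` (S \<times> S))"
    using assms(1) by (auto intro!: bdd_aboveI2[where M = D])
  from cSUP_upper[OF _ this, of "(x, y)"] show ?thesis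
    using assms(2,3) by (auto simp: set_diameter_def)
qed

context Metric_space
begin

lemma hausdorff_dist_le:
  assumes "\<And>x y. x \<in> W \<Longrightarrow> y \<in> W \<Longrightarrow> d x y \<le> D"
    and "B \<subseteq> W" "C \<subseteq> W" "B \<noteq> {}" "C \<noteq> {}"
  shows "hausdorff_dist d B C \<le> D"
proof -
  have "point_set_dist d b S \<le> D" if "b \<in> W" "S \<subseteq> W" "S \<noteq> {}" for b S
  proof -
    obtain c where c: "c \<in> S" using \<open>S \<noteq> {}\<close> by blast
    have "point_set_dist d b S \<le> d b c"
      unfolding point_set_dist_def using c by (intro cINF_lower bdd_belowI2[where m = 0]) auto
    also have "\<dots> \<le> D" using assms(1) that c by blast
    finally show ?thesis .
  qed
  then show ?thesis
    using assms(2-) unfolding hausdorff_dist_def by (intro max.boundedI cSUP_least) blast+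
qed

lemma hausdorff_dist_singletons: "hausdorff_dist d {x} {y} = d x y"
  by (simp add: hausdorff_dist_def point_set_dist_def commute)

lemma set_diameter_compacts_in:
  assumes "mbounded W"
  shows "set_diameter (hausdorff_dist d) (compacts_in M d W) = set_diameter d W"
proof (cases "W = {}")
  case True
  \<comment> \<open>The empty set has no nonempty subset, so both diameters take the default value
    0.\<close>
  then show ?thesis by (auto simp: compacts_in_def compacts_def set_diameter_def)
next
  case False
  let ?H = "hausdorff_dist d"
  obtain D where D: "\<And>x y. x \<in> W \<Longrightarrow> y \<in> W \<Longrightarrow> d x y \<le> D"
    using assms by (auto simp: mbounded_alt)
  have "W \<subseteq> M" using assms by (rule mbounded_subset_mspace)
  then have single: "{x} \<in> compacts_in M d W" if "x \<in> W" for x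
    using that by (auto simp: compacts_in_def compacts_def intro: finite_imp_compactin)
  \<comment> \<open>Kept general in \<open>e\<close>: the diameter of \<open>W\<close> gives the
    upper estimate, while \<open>D\<close> shows that the supremum over Hausdorff distances is
    bounded.\<close>
  have H_le: "?H B C \<le> e"
    if "\<And>x y. x \<in> W \<Longrightarrow> y \<in> W \<Longrightarrow> d x y \<le> e" "B \<in> compacts_in M d W" "C \<in> compacts_in M d W"
    for B C e
    using that by (intro hausdorff_dist_le[of W]) (auto simp: compacts_in_def compacts_def)
  show ?thesis
  proof (rule antisym)
    show "set_diameter ?H (compacts_in M d W) \<le> set_diameter d W"
      using single False
      by (intro set_diameter_least H_le set_diameter_upper[of W d, OF D]) auto
    show "set_diameter d W \<le> set_diameter ?H (compacts_in M d W)"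
    proof (rule set_diameter_least)
      fix x y assume "x \<in> W" "y \<in> W"
      then show "d x y \<le> set_diameter ?H (compacts_in M d W)"
        using set_diameter_upper[of _ ?H, OF H_le[OF D] single single]
        by (simp add: hausdorff_dist_singletons)
    qed (fact False)
  qed
qed

end

lemma iter_induced_map: "iter (induced_map f) n k B = iter f n k ` B"
  by (induction k) (simp_all add: induced_map_def image_comp)

lemma continuous_map_iter:
  assumes "\<And>n. continuous_map T T (f n)"
  shows "continuous_map T T (iter f n k)"
proof (induction k)
  case (Suc k)
  then show ?case unfolding iter.simps by (rule continuous_map_compose[OF _ assms])
qed (simp add: id_def)

lemma H_itin_eq_compacts_in:
  assumes "Metric_space X d"
    and "\<And>n. continuous_map (Metric_space.mtopology X d) (Metric_space.mtopology X d) (f n)"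
  shows "H_itin X d f V \<alpha> m n = compacts_in X d (V_itin X f V \<alpha> m n)"
proof -
  interpret Metric_space X d by fact
  \<comment> \<open>Membership in \<langle>V\<rangle> asks the iterated image to be compact and
    nonempty as well as contained in V; continuity supplies this.\<close>
  have compact: "iter f n k ` B \<in> compacts X d" if "B \<in> compacts X d" for B k
    using that continuous_map_iter[where f = f, OF assms(2)]
    by (auto simp: compacts_def intro: image_compactin)
  \<comment> \<open>Needed because the preimages that form \<open>V_itin\<close> are cut down to
    \<open>X\<close>.\<close>
  have "B \<subseteq> X" if "B \<in> compacts X d" for B
    using that compactin_subset_topspace[of mtopology B] by (simp add: compacts_def)
  with compact show ?thesis
    by (fastforce simp: H_itin_def V_itin_def iter_preimage_def compacts_in_def iter_induced_map)
qed

theorem proposition4p3: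
  fixes X :: "'a set"
    and d :: "'a \<Rightarrow> 'a \<Rightarrow> real"
    and f :: "nat \<Rightarrow> 'a \<Rightarrow> 'a"
    and N :: nat
    and A :: "nat \<Rightarrow> nat \<Rightarrow> nat"
    and V :: "nat \<Rightarrow> nat \<Rightarrow> 'a set"
  assumes "Metric_space X d"
    and "compact_space (Metric_space.mtopology X d)"
    and "\<And>n. continuous_map (Metric_space.mtopology X d) (Metric_space.mtopology X d) (f n)"
    and "transition_matrix N A"
    and "\<And>i n. i \<in> {1..N} \<Longrightarrow> closedin (Metric_space.mtopology X d) (V i n) \<and> V i n \<noteq> {}"
  shows "(\<forall>\<alpha>\<in>one_sided_shift N A. \<forall>n.
            (\<lambda>m. set_diameter d (V_itin X f V \<alpha> m n)) \<longlonglongrightarrow> 0 \<longleftrightarrow>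
            (\<lambda>m. set_diameter (hausdorff_dist d) (H_itin X d f V \<alpha> m n)) \<longlonglongrightarrow> 0) \<and>
         (\<forall>\<alpha>\<in>one_sided_shift N A.
            uniform_limit UNIV (\<lambda>m n. set_diameter d (V_itin X f V \<alpha> m n)) (\<lambda>n. 0) sequentially \<longleftrightarrow>
            uniform_limit UNIV (\<lambda>m n. set_diameter (hausdorff_dist d) (H_itin X d f V \<alpha> m n)) (\<lambda>n. 0) sequentially)"
proof -
  interpret Metric_space X d by fact
  have "mbounded (V_itin X f V \<alpha> m n)" for \<alpha> m n
  proof (rule mbounded_subset)
    show "mbounded X" using assms(2) by (simp add: compact_space_def compactin_imp_mbounded)
    \<comment> \<open>The index set \<open>{0..m}\<close> contains 0, so the intersection is over a
      nonempty family of subsets of \<open>X\<close>.\<close>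
    show "V_itin X f V \<alpha> m n \<subseteq> X" by (auto simp: V_itin_def iter_preimage_def)
  qed
  then have "set_diameter (hausdorff_dist d) (H_itin X d f V \<alpha> m n) =
      set_diameter d (V_itin X f V \<alpha> m n)" for \<alpha> m n
    using H_itin_eq_compacts_in[OF assms(1,3)] by (simp add: set_diameter_compacts_in)
  \<comment> \<open>The diameters agree for every \<open>m\<close> and \<open>n\<close>, so
    rewriting makes the two sides of each equivalence identical, the uniform one included.\<close>
  then show ?thesis by simp
qed

end
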